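(* Let $G$ be a compact Hausdorff Abelian group, let $G^\wedge$ be its dual group with counting measure $\nu$, let $p$ be a continuous invariant pseudo-metric on $G^\wedge$, and let $\gamma(\xi):=p(\xi,1)$ for $\xi\in G^\wedge$. Suppose that the operator $T:L^2(G^\wedge)\to L^2(G^\wedge)$ defined by $$[T(f)](\xi):=\frac{f(\xi)}{\sqrt{1+\gamma(\xi)^2}},\qquad \xi\in G^\wedge,$$ is compact, and that there exists a subset $S_0\subset G^\wedge$ generating $G^\wedge$ as a group such that $\gamma$ is bounded on $S_0$. Then $G^\wedge$ is finitely generated.
   Context: $G^\wedge$ is the group of continuous homomorphisms $\xi:G\to\mathbb{S}^1$ with identity element $1$ (discrete since $G$ is compact). A pseudo-metric $p$ on $G^\wedge$ is invariant if it is invariant under translations of the group. $L^2(G^\wedge)$ is taken with respect to the counting measure $\nu$. A subset $S$ of a group generates it if the smallest subgroup containing $S$ is the whole group; a group is finitely generated if it has a finite generating subset. *)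

theory Defs
  imports "HOL-Analysis.Analysis" "HOL-Algebra.Generated_Groups"
begin

definition dual_group :: "('a::topological_ab_group_add \<Rightarrow> complex) monoid" where
  "dual_group =
     \<lparr>carrier = {\<xi>. continuous_on UNIV \<xi> \<and> (\<forall>x. \<xi> x \<in> sphere 0 1) \<and>
                   (\<forall>x y. \<xi> (x + y) = \<xi> x * \<xi> y)},
      mult = (\<lambda>\<xi> \<eta> x. \<xi> x * \<eta> x),
      one = (\<lambda>x. 1)\<rparr>"

text \<open>The compact-open topology; it is discrete when the group is compact.\<close>

definition dual_topology :: "('a::topological_ab_group_add \<Rightarrow> complex) topology" where
  "dual_topology =
     subtopology
       (topology_generated_by {{\<xi>. \<xi> ` K \<subseteq> U} | K U. compact K \<and> open U})
       (carrier dual_group)"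

lemma topspace_dual_topology: "topspace dual_topology = carrier dual_group"
proof -
  have "{\<xi>. \<xi> ` {} \<subseteq> (UNIV :: complex set)}
          \<in> {{\<xi>. \<xi> ` K \<subseteq> U} | K U. compact (K :: 'a set) \<and> open U}"
    by (intro CollectI exI[of _ "{} :: 'a set"] exI[of _ "UNIV :: complex set"]) auto
  then show ?thesis
    unfolding dual_topology_def topspace_subtopology topology_generated_by_topspace by blast
qed

lemma comm_group_dual_group:
  "comm_group (dual_group :: ('a::topological_ab_group_add \<Rightarrow> complex) monoid)"
proof (rule comm_groupI)
  fix \<xi> :: "'a \<Rightarrow> complex"
  assume \<xi>: "\<xi> \<in> carrier dual_group"
  then have "norm (\<xi> x) = 1" for x
    by (simp add: dual_group_def)
  then have n: "\<xi> x \<noteq> 0" for x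
    by (metis norm_zero zero_neq_one)
  have "(\<lambda>x. inverse (\<xi> x)) \<in> carrier dual_group"
    using \<xi> n by (auto simp: dual_group_def norm_inverse intro!: continuous_on_inverse)
  moreover have "(\<lambda>x. inverse (\<xi> x)) \<otimes>\<^bsub>dual_group\<^esub> \<xi> = \<one>\<^bsub>dual_group\<^esub>"
    using n by (auto simp: dual_group_def)
  ultimately show "\<exists>\<eta>\<in>carrier dual_group. \<eta> \<otimes>\<^bsub>dual_group\<^esub> \<xi> = \<one>\<^bsub>dual_group\<^esub>"
    by blast
qed (auto simp: dual_group_def norm_mult algebra_simps intro!: continuous_on_mult)

definition finitely_generated_group :: "('g, 'm) monoid_scheme \<Rightarrow> bool" where
  "finitely_generated_group G \<longleftrightarrow>
     (\<exists>S. finite S \<and> S \<subseteq> carrier G \<and> generate G S = carrier G)"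

definition pseudo_metric_on :: "'b set \<Rightarrow> ('b \<Rightarrow> 'b \<Rightarrow> real) \<Rightarrow> bool" where
  "pseudo_metric_on A p \<longleftrightarrow>
     (\<forall>x\<in>A. \<forall>y\<in>A. 0 \<le> p x y) \<and>
     (\<forall>x\<in>A. p x x = 0) \<and>
     (\<forall>x\<in>A. \<forall>y\<in>A. p x y = p y x) \<and>
     (\<forall>x\<in>A. \<forall>y\<in>A. \<forall>z\<in>A. p x z \<le> p x y + p y z)"

text \<open>One-sided translations suffice here, since the notion is only used for Abelian groups.\<close>

definition translation_invariant ::
    "('g, 'm) monoid_scheme \<Rightarrow> ('g \<Rightarrow> 'g \<Rightarrow> real) \<Rightarrow> bool" where
  "translation_invariant G p \<longleftrightarrow>
     (\<forall>z\<in>carrier G. \<forall>x\<in>carrier G. \<forall>y\<in>carrier G. p (z \<otimes>\<^bsub>G\<^esub> x) (z \<otimes>\<^bsub>G\<^esub> y) = p x y)"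

text \<open>
  Null sets of the counting measure are empty, so elements of \<open>L\<^sup>2\<close> are genuine functions on \<open>A\<close>.
  A function on \<open>A\<close> is represented by its extension by zero, which makes the
  pointwise operations on the ambient function type the vector space operations of \<open>L\<^sup>2\<close>.
\<close>

definition L2_space :: "'b set \<Rightarrow> ('b \<Rightarrow> complex) set" where
  "L2_space A = {f. (\<forall>x. x \<notin> A \<longrightarrow> f x = 0) \<and>
                    integrable (count_space A) (\<lambda>x. (norm (f x))\<^sup>2)}"

definition L2_dist :: "'b set \<Rightarrow> ('b \<Rightarrow> complex) \<Rightarrow> ('b \<Rightarrow> complex) \<Rightarrow> real" where
  "L2_dist A f g = sqrt (LINT x|count_space A. (norm (f x - g x))\<^sup>2)"

lemma L2_diff_integrable:
  assumes "f \<in> L2_space A" "g \<in> L2_space A"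
  shows "integrable (count_space A) (\<lambda>x. (norm (f x - g x))\<^sup>2)"
proof (rule Bochner_Integration.integrable_bound)
  show "integrable (count_space A) (\<lambda>x. 2 * (norm (f x))\<^sup>2 + 2 * (norm (g x))\<^sup>2)"
    using assms by (auto simp: L2_space_def)
  have "(norm (a - b))\<^sup>2 \<le> 2 * (norm a)\<^sup>2 + 2 * (norm b)\<^sup>2" for a b :: complex
  proof -
    have "(norm (a - b))\<^sup>2 \<le> (norm a + norm b)\<^sup>2"
      by (intro power_mono norm_triangle_ineq4) auto
    also have "\<dots> \<le> 2 * (norm a)\<^sup>2 + 2 * (norm b)\<^sup>2"
      using zero_le_power2[of "norm a - norm b"]
      by (simp add: power2_eq_square algebra_simps)
    finally show ?thesis .
  qed
  then show "AE x in count_space A.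
      norm ((norm (f x - g x))\<^sup>2) \<le> norm (2 * (norm (f x))\<^sup>2 + 2 * (norm (g x))\<^sup>2)"
    by simp
qed auto

lemma L2_dist_triangle:
  assumes f: "f \<in> L2_space A" and g: "g \<in> L2_space A" and h: "h \<in> L2_space A"
  shows "L2_dist A f h \<le> L2_dist A f g + L2_dist A g h"
proof -
  define u where "u = (\<lambda>x. norm (f x - g x))"
  define v where "v = (\<lambda>x. norm (g x - h x))"
  define U where "U = (LINT x|count_space A. (u x)\<^sup>2)"
  define V where "V = (LINT x|count_space A. (v x)\<^sup>2)"
  have iu: "integrable (count_space A) (\<lambda>x. (u x)\<^sup>2)"
    and iv: "integrable (count_space A) (\<lambda>x. (v x)\<^sup>2)"
    unfolding u_def v_def using f g h by (auto intro: L2_diff_integrable)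
  have UV: "0 \<le> U" "0 \<le> V"
    by (auto simp: U_def V_def)
  have key: "(LINT x|count_space A. (norm (f x - h x))\<^sup>2) \<le> (1 + c) * U + (1 + 1/c) * V"
    if c: "0 < c" for c
  proof -
    have "(norm (f x - h x))\<^sup>2 \<le> (1 + c) * (u x)\<^sup>2 + (1 + 1/c) * (v x)\<^sup>2" for x
    proof -
      have "norm (f x - h x) \<le> u x + v x"
        unfolding u_def v_def by (metis dist_norm dist_triangle)
      then have "(norm (f x - h x))\<^sup>2 \<le> (u x + v x)\<^sup>2"
        by (intro power_mono) auto
      also have "\<dots> = (1 + c) * (u x)\<^sup>2 + (1 + 1/c) * (v x)\<^sup>2 - (c * u x - v x)\<^sup>2 / c"
        using c by (simp add: field_simps power2_eq_square)
      also have "\<dots> \<le> (1 + c) * (u x)\<^sup>2 + (1 + 1/c) * (v x)\<^sup>2"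
        using c by simp
      finally show ?thesis .
    qed
    then have "(LINT x|count_space A. (norm (f x - h x))\<^sup>2)
        \<le> (LINT x|count_space A. (1 + c) * (u x)\<^sup>2 + (1 + 1/c) * (v x)\<^sup>2)"
      using iu iv f h by (intro integral_mono L2_diff_integrable) auto
    also have "\<dots> = (1 + c) * U + (1 + 1/c) * V"
      unfolding U_def V_def using iu iv by simp
    finally show ?thesis .
  qed
  define W where "W = (LINT x|count_space A. (norm (f x - h x))\<^sup>2)"
  have "W \<le> (sqrt U + sqrt V + 2 * e)\<^sup>2" if e: "0 < e" for e
  proof -
    define a where "a = sqrt U + e"
    define b where "b = sqrt V + e"
    have ab: "0 < a" "0 < b" using e UV by (auto simp: a_def b_def add_nonneg_pos)
    have "sqrt U \<le> a" "sqrt V \<le> b" using e by (auto simp: a_def b_def)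
    then have ua: "U \<le> a\<^sup>2" "V \<le> b\<^sup>2"
      using UV ab by (auto simp: sqrt_le_D)
    have "W \<le> (1 + b/a) * U + (1 + 1/(b/a)) * V"
      unfolding W_def using ab by (intro key) auto
    also have "\<dots> \<le> (1 + b/a) * a\<^sup>2 + (1 + 1/(b/a)) * b\<^sup>2"
      using ab ua by (intro add_mono mult_left_mono) auto
    also have "\<dots> = (a + b)\<^sup>2"
      using ab by (simp add: field_simps power2_eq_square)
    finally show ?thesis by (simp add: a_def b_def algebra_simps)
  qed
  then have "sqrt W \<le> sqrt U + sqrt V + 2 * e" if "0 < e" for e
    using that UV by (intro real_le_lsqrt) auto
  then have "sqrt W \<le> sqrt U + sqrt V + e" if "0 < e" for e
    using that[THEN half_gt_zero] by (metis field_sum_of_halves mult_2)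
  then have "sqrt W \<le> sqrt U + sqrt V"
    by (rule field_le_epsilon)
  then show ?thesis
    by (simp add: W_def U_def V_def u_def v_def L2_dist_def)
qed

lemma Metric_space_L2: "Metric_space (L2_space A) (L2_dist A)"
proof
  fix f g :: "'a \<Rightarrow> complex"
  show "0 \<le> L2_dist A f g" "L2_dist A f g = L2_dist A g f"
    by (auto simp: L2_dist_def norm_minus_commute)
  assume fg: "f \<in> L2_space A" "g \<in> L2_space A"
  have "(LINT x|count_space A. (norm (f x - g x))\<^sup>2) = 0 \<longleftrightarrow> (\<forall>x\<in>A. f x = g x)"
    by (subst integral_nonneg_eq_0_iff_AE[OF L2_diff_integrable[OF fg]])
       (auto simp: AE_count_space)
  also have "\<dots> \<longleftrightarrow> f = g"
    using fg by (auto simp: L2_space_def fun_eq_iff)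
  finally show "L2_dist A f g = 0 \<longleftrightarrow> f = g"
    by (simp add: L2_dist_def)
qed (rule L2_dist_triangle)

definition compact_operator_L2 ::
    "'b set \<Rightarrow> (('b \<Rightarrow> complex) \<Rightarrow> ('b \<Rightarrow> complex)) \<Rightarrow> bool" where
  "compact_operator_L2 A T \<longleftrightarrow>
     (\<forall>f\<in>L2_space A. T f \<in> L2_space A) \<and>
     (\<forall>f\<in>L2_space A. \<forall>g\<in>L2_space A. T (\<lambda>x. f x + g x) = (\<lambda>x. T f x + T g x)) \<and>
     (\<forall>c. \<forall>f\<in>L2_space A. T (\<lambda>x. c * f x) = (\<lambda>x. c * T f x)) \<and>
     (\<forall>B. B \<subseteq> L2_space A \<and> Metric_space.mbounded (L2_space A) (L2_dist A) B \<longrightarrow>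
        compactin (Metric_space.mtopology (L2_space A) (L2_dist A))
          (Metric_space.mtopology (L2_space A) (L2_dist A) closure_of (T ` B)))"

end

theory Submission
  imports Defs
begin

text \<open>
  The operator \<open>T\<close> is multiplication by a function \<open>m\<close>, so every point mass is an eigenvector of
  \<open>T\<close>, and the eigenvalue at \<open>\<xi>\<close> is \<open>m \<xi>\<close>.  Distinct point masses are orthonormal.  Hence the
  images of infinitely many point masses with eigenvalues bounded away from \<open>0\<close> would be an infinite
  uniformly separated set, although a compact operator maps the bounded set of all point masses to a
  totally bounded set.  So \<open>m\<close> tends to \<open>0\<close> at infinity
  (\<open>finite_level_set_of_compact_multiplication\<close>).  A bound on \<open>\<gamma>\<close> over a generating set bounds
  \<open>m = 1 / sqrt (1 + \<gamma>\<^sup>2)\<close> away from \<open>0\<close> there, and the generating set is therefore already finite.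
\<close>

text \<open>By the triangle inequality, a ball of radius \<open>e/2\<close> holds at most one point of the set.\<close>

lemma (in Metric_space) finite_if_mtotally_bounded_separated:
  assumes S: "mtotally_bounded S" and e: "0 < e"
    and sep: "\<And>x y. x \<in> S \<Longrightarrow> y \<in> S \<Longrightarrow> x \<noteq> y \<Longrightarrow> e \<le> d x y"
  shows "finite S"
proof -
  obtain K where K: "finite K" "S \<subseteq> (\<Union>k\<in>K. mball k (e/2))"
    using S e unfolding mtotally_bounded_def by (meson half_gt_zero)
  have "finite (S \<inter> mball k (e/2))" for k
  proof -
    have "x = y" if "x \<in> S \<inter> mball k (e/2)" "y \<in> S \<inter> mball k (e/2)" for x y
    proof (rule ccontr)
      assume "x \<noteq> y"
      then have "e \<le> d x y" using that sep by auto
      moreover have "d x y \<le> d k x + d k y"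
        using that triangle[of x k y] by (auto simp: commute)
      ultimately show False using that by auto
    qed
    then have "S \<inter> mball k (e/2) \<subseteq> {x}" if "x \<in> S \<inter> mball k (e/2)" for x
      using that by blast
    then show ?thesis by (metis finite.emptyI finite_insert finite_subset ex_in_conv)
  qed
  then have "finite (\<Union>k\<in>K. S \<inter> mball k (e/2))" using K by blast
  moreover have "S \<subseteq> (\<Union>k\<in>K. S \<inter> mball k (e/2))" using K by blast
  ultimately show ?thesis by (rule finite_subset[rotated])
qed

text \<open>
  Point evaluations are contractions on \<open>L\<^sup>2\<close> of a counting measure, since the squared value at one
  point is one term of the sum.  This separates images of point masses without computing distances.
\<close>

lemma norm_diff_le_L2_dist:
  assumes "f \<in> L2_space A" "g \<in> L2_space A" and x: "x \<in> A"
  shows "norm (f x - g x) \<le> L2_dist A f g"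
proof -
  have "(norm (f x - g x))\<^sup>2 = (LINT y|count_space A. (if y = x then (norm (f y - g y))\<^sup>2 else 0))"
    using x by (subst lebesgue_integral_count_space_finite_support)
      (auto simp: if_distrib[of norm] sum.delta intro: finite_subset[of _ "{x}"])
  also have "\<dots> \<le> (LINT y|count_space A. (norm (f y - g y))\<^sup>2)"
    using L2_diff_integrable[OF assms(1,2)] by (intro integral_mono') auto
  finally show ?thesis
    unfolding L2_dist_def by (rule real_le_rsqrt)
qed

definition point_mass :: "'b \<Rightarrow> 'b \<Rightarrow> complex" where
  "point_mass x = (\<lambda>y. of_bool (y = x))"

lemma norm_point_mass_squared: "(norm (point_mass x y))\<^sup>2 = indicator {x} y"
  by (simp add: point_mass_def indicator_def)

lemma point_mass_in_L2:
  assumes "x \<in> A"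
  shows "point_mass x \<in> L2_space A"
proof -
  have "integrable (count_space A) (indicator {x} :: _ \<Rightarrow> real)"
    using assms by (intro integrable_real_indicator) auto
  then show ?thesis
    using assms by (auto simp: L2_space_def norm_point_mass_squared) (auto simp: point_mass_def)
qed

lemma zero_in_L2: "(\<lambda>_. 0) \<in> L2_space A"
  by (simp add: L2_space_def)

lemma L2_dist_zero_point_mass:
  assumes "x \<in> A"
  shows "L2_dist A (\<lambda>_. 0) (point_mass x) = 1"
  using assms by (simp add: L2_dist_def norm_point_mass_squared)

lemma mbounded_point_masses:
  assumes "X \<subseteq> A"
  shows "Metric_space.mbounded (L2_space A) (L2_dist A) (point_mass ` X)"
proof -
  interpret L2: Metric_space "L2_space A" "L2_dist A"
    by (rule Metric_space_L2)
  have "point_mass ` X \<subseteq> L2.mcball (\<lambda>_. 0) 1"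
    using assms by (auto simp: zero_in_L2 point_mass_in_L2 L2_dist_zero_point_mass subset_iff)
  then show ?thesis
    unfolding L2.mbounded_def by blast
qed

text \<open>
  The images of the point masses on the level set are pairwise at distance at least \<open>e\<close>, since two of
  them already differ by \<open>norm (m x) \<ge> e\<close> at a point \<open>x\<close> where one is supported and the other is not.
  Compactness makes this separated set totally bounded.
\<close>

lemma finite_level_set_of_compact_multiplication:
  assumes T: "compact_operator_L2 A (\<lambda>f x. m x * f x)" and e: "0 < e"
  shows "finite {x \<in> A. e \<le> norm (m x)}"
proof -
  interpret L2: Metric_space "L2_space A" "L2_dist A"
    by (rule Metric_space_L2)
  define X where "X = {x \<in> A. e \<le> norm (m x)}"
  define F where "F = (\<lambda>x y. m x * point_mass x y)"
  have image: "(\<lambda>y. m y * point_mass x y) = F x" for x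
    by (auto simp: F_def point_mass_def)
  have FL2: "F x \<in> L2_space A" if "x \<in> X" for x
    using T point_mass_in_L2[of x A] that
    unfolding image[symmetric] by (auto simp: compact_operator_L2_def X_def)
  have sep: "e \<le> L2_dist A (F x) (F y)" if "x \<in> X" "y \<in> X" "x \<noteq> y" for x y
  proof -
    have "norm (F x x - F y x) \<le> L2_dist A (F x) (F y)"
      using that FL2 by (intro norm_diff_le_L2_dist) (auto simp: X_def)
    moreover have "norm (F x x - F y x) = norm (m x)"
      using that by (simp add: F_def point_mass_def)
    ultimately show ?thesis using that by (simp add: X_def)
  qed
  have "point_mass ` X \<subseteq> L2_space A \<and> L2.mbounded (point_mass ` X)"
    using mbounded_point_masses[of X A] L2.mbounded_subset_mspace by (auto simp: X_def)
  then have "compactin L2.mtopology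
      (L2.mtopology closure_of ((\<lambda>f x. m x * f x) ` (point_mass ` X)))"
    using T unfolding compact_operator_L2_def by blast
  then have "compactin L2.mtopology (L2.mtopology closure_of (F ` X))"
    by (simp add: image_image image)
  then have "L2.mtotally_bounded (L2.mtopology closure_of (F ` X))"
    by (rule L2.compactin_imp_mtotally_bounded)
  moreover have "F ` X \<subseteq> L2.mtopology closure_of (F ` X)"
    using FL2 by (intro closure_of_subset) auto
  ultimately have "L2.mtotally_bounded (F ` X)"
    by (rule L2.mtotally_bounded_subset)
  then have "finite (F ` X)"
    using e by (rule L2.finite_if_mtotally_bounded_separated) (use sep in auto)
  moreover have "inj_on F X"
  proof (rule inj_onI)
    fix x y assume "x \<in> X" "y \<in> X" "F x = F y"
    then show "x = y"
      using sep[of x y] e L2.mdist_zero[OF FL2, of y] by fastforce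
  qed
  ultimately show ?thesis
    unfolding X_def by (rule finite_imageD)
qed

theorem theorem4p7:
  fixes p :: "('a::{topological_ab_group_add, t2_space} \<Rightarrow> complex) \<Rightarrow> ('a \<Rightarrow> complex) \<Rightarrow> real"
    and \<gamma> :: "('a \<Rightarrow> complex) \<Rightarrow> real"
    and T :: "(('a \<Rightarrow> complex) \<Rightarrow> complex) \<Rightarrow> (('a \<Rightarrow> complex) \<Rightarrow> complex)"
  assumes "compact (UNIV :: 'a set)"
    and "pseudo_metric_on (carrier dual_group) p"
    and "translation_invariant dual_group p"
    and "continuous_map (prod_topology dual_topology dual_topology) euclideanreal
           (\<lambda>(\<xi>, \<eta>). p \<xi> \<eta>)"
    and "\<gamma> = (\<lambda>\<xi>. p \<xi> \<one>\<^bsub>dual_group\<^esub>)"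
    and "T = (\<lambda>f \<xi>. f \<xi> / complex_of_real (sqrt (1 + (\<gamma> \<xi>)\<^sup>2)))"
    and "compact_operator_L2 (carrier dual_group) T"
    and "\<exists>S\<^sub>0 \<subseteq> carrier dual_group.
           generate dual_group S\<^sub>0 = carrier dual_group \<and> bounded (\<gamma> ` S\<^sub>0)"
  shows "finitely_generated_group
           (dual_group :: ('a \<Rightarrow> complex) monoid)"
proof -
  obtain S :: "('a \<Rightarrow> complex) set" where S: "S \<subseteq> carrier dual_group"
    "generate dual_group S = carrier dual_group" "bounded (\<gamma> ` S)"
    using assms(8) by blast
  obtain M where M: "\<And>\<xi>. \<xi> \<in> S \<Longrightarrow> \<bar>\<gamma> \<xi>\<bar> \<le> M"
    using S(3) by (auto simp: bounded_iff)
  define m where "m = (\<lambda>\<xi>. complex_of_real (1 / sqrt (1 + (\<gamma> \<xi>)\<^sup>2)))"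
  define e where "e = 1 / sqrt (1 + M\<^sup>2)"
  have pos: "0 < 1 + t\<^sup>2" for t :: real
    by (simp add: add_pos_nonneg)
  have "T = (\<lambda>f \<xi>. m \<xi> * f \<xi>)"
    by (simp add: assms(6) m_def)
  then have fin: "finite {\<xi> \<in> carrier dual_group. e \<le> norm (m \<xi>)}"
    using assms(7) pos by (intro finite_level_set_of_compact_multiplication) (auto simp: e_def)
  have "e \<le> norm (m \<xi>)" if "\<xi> \<in> S" for \<xi>
  proof -
    have "(\<gamma> \<xi>)\<^sup>2 \<le> M\<^sup>2"
      using M[OF that] by (simp add: abs_le_square_iff[symmetric])
    then have "e \<le> 1 / sqrt (1 + (\<gamma> \<xi>)\<^sup>2)"
      unfolding e_def using pos by (intro divide_left_mono mult_pos_pos) auto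
    then show ?thesis
      unfolding m_def norm_of_real by linarith
  qed
  then have "finite S"
    using S(1) by (intro finite_subset[OF _ fin]) auto
  then show ?thesis
    using S unfolding finitely_generated_group_def by blast
qed

end
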